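(* Let $1<p<\infty$ and let $(V,\mu)$ be an infinite, connected, locally finite weighted graph satisfying the volume doubling condition (VD), the Poincaré inequality (PI) and condition $(P_0)$. If there exist some $o\in V$ and a constant $C>0$ such that $$V(o,r)\le C\,r^{2p}(\log r)^{p-1}\qquad\text{for all large enough } r,$$ then $(V,\mu)$ is $L^p$-parabolic.
   Context: Weighted graph: $(V,E)$ is an infinite, connected, locally finite graph (loops allowed), and $\mu:V\times V\to[0,\infty)$, $\mu_{xy}=\mu_{yx}$, with $\mu_{xy}>0$ iff $x\sim y$. Vertex weight: $\mu(x)=\sum_{y\sim x}\mu_{xy}$; $\mu(A)=\sum_{x\in A}\mu(x)$ for $A\subset V$. $d$ is the graph distance, $B(x,r)=\{y\in V: d(x,y)\le r\}$, $V(x,r)=\mu(B(x,r))$. (VD): there is a constant $C$ such that $V(x,2r)\le C\,V(x,r)$ for all $x\in V$ and all $r>0$. (PI): there is a constant $C$ such that for all $x_0\in V$, all $r>0$ and all $f:V\to\mathbb R$, $$\sum_{x\in B(x_0,r)}|f(x)-f_B|^2\mu(x)\le C\,r^2\sum_{x,y\in B(x_0,2r)}\mu_{xy}(f(y)-f(x))^2,$$ where $f_B=\frac1{V(x_0,r)}\sum_{x\in B(x_0,r)}f(x)\mu(x)$. $(P_0)$: there is a constant $\alpha>0$ such that $\mu_{xy}/\mu(x)\ge\alpha$ whenever $x\sim y$. Random walk: $P(x,y)=\mu_{xy}/\mu(x)$, with $n$-step transition function $P_n(x,y)$, $P_0(x,y)=\mathbf 1_{\{x=y\}}$, and $p_n(x,y)=P_n(x,y)/\mu(y)$.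 Green function: $g(x,y)=\sum_{n\ge0}p_n(x,y)\in(0,\infty]$. Green operator: for $f\ge0$, $Gf(x)=\sum_{y\in V}g(x,y)f(y)\mu(y)\in[0,\infty]$ (with $\infty\cdot0=0$). With $\frac1p+\frac1q=1$ and $\|f\|_{L^q(V)}=(\sum_{x\in V}|f(x)|^q\mu(x))^{1/q}$, the $L^p$-capacity of a finite set $K\subset V$ is $$C_p(K)=\sup\Big\{\Big(\sum_{x\in K}f(x)\mu(x)\Big)^p:\ f\ge0\text{ a function supported in }K,\ \|Gf\|_{L^q(V)}\le1\Big\}.$$ $(V,\mu)$ is $L^p$-parabolic if $C_p(K)=0$ for every finite $K\subset V$. *)

theory Defs
  imports "HOL-Analysis.Analysis"
begin

text \<open>
  The vertex set is the whole type \<open>'a\<close>, \<open>E x y\<close> is adjacency (loops \<open>E x x\<close> are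
  allowed), and \<open>\<mu>\<close> is the edge weight.
\<close>

locale weighted_graph =
  fixes E :: "'a \<Rightarrow> 'a \<Rightarrow> bool" and \<mu> :: "'a \<Rightarrow> 'a \<Rightarrow> real"
  assumes infinite_vertices: "infinite (UNIV :: 'a set)"
    and adj_sym: "E x y \<Longrightarrow> E y x"
    and connected: "E\<^sup>*\<^sup>* x y"
    and locally_finite: "finite {y. E x y}"
    and weight_nonneg: "0 \<le> \<mu> x y"
    and weight_sym: "\<mu> x y = \<mu> y x"
    and weight_pos_iff: "0 < \<mu> x y \<longleftrightarrow> E x y"

definition vertex_weight :: "('a \<Rightarrow> 'a \<Rightarrow> bool) \<Rightarrow> ('a \<Rightarrow> 'a \<Rightarrow> real) \<Rightarrow> 'a \<Rightarrow> real" where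
  "vertex_weight E \<mu> x = (\<Sum>y | E x y. \<mu> x y)"

definition graph_dist :: "('a \<Rightarrow> 'a \<Rightarrow> bool) \<Rightarrow> 'a \<Rightarrow> 'a \<Rightarrow> nat" where
  "graph_dist E x y = (LEAST n. (E ^^ n) x y)"

definition graph_ball :: "('a \<Rightarrow> 'a \<Rightarrow> bool) \<Rightarrow> 'a \<Rightarrow> real \<Rightarrow> 'a set" where
  "graph_ball E x r = {y. real (graph_dist E x y) \<le> r}"

text \<open>Balls are finite by local finiteness (lemma \<open>finite_graph_ball\<close>), so the finite
  sums over balls below are not degenerate.\<close>

definition graph_volume :: "('a \<Rightarrow> 'a \<Rightarrow> bool) \<Rightarrow> ('a \<Rightarrow> 'a \<Rightarrow> real) \<Rightarrow> 'a \<Rightarrow> real \<Rightarrow> real" where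
  "graph_volume E \<mu> x r = (\<Sum>y\<in>graph_ball E x r. vertex_weight E \<mu> y)"

definition volume_doubling :: "('a \<Rightarrow> 'a \<Rightarrow> bool) \<Rightarrow> ('a \<Rightarrow> 'a \<Rightarrow> real) \<Rightarrow> bool" where
  "volume_doubling E \<mu> \<longleftrightarrow>
    (\<exists>C. \<forall>x. \<forall>r>0. graph_volume E \<mu> x (2 * r) \<le> C * graph_volume E \<mu> x r)"

definition ball_mean ::
    "('a \<Rightarrow> 'a \<Rightarrow> bool) \<Rightarrow> ('a \<Rightarrow> 'a \<Rightarrow> real) \<Rightarrow> 'a \<Rightarrow> real \<Rightarrow> ('a \<Rightarrow> real) \<Rightarrow> real" where
  "ball_mean E \<mu> x\<^sub>0 r f =
    1 / graph_volume E \<mu> x\<^sub>0 r * (\<Sum>x\<in>graph_ball E x\<^sub>0 r. f x * vertex_weight E \<mu> x)"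

definition poincare_inequality :: "('a \<Rightarrow> 'a \<Rightarrow> bool) \<Rightarrow> ('a \<Rightarrow> 'a \<Rightarrow> real) \<Rightarrow> bool" where
  "poincare_inequality E \<mu> \<longleftrightarrow>
    (\<exists>C. \<forall>x\<^sub>0. \<forall>r>0. \<forall>f :: 'a \<Rightarrow> real.
      (\<Sum>x\<in>graph_ball E x\<^sub>0 r. \<bar>f x - ball_mean E \<mu> x\<^sub>0 r f\<bar>\<^sup>2 * vertex_weight E \<mu> x)
      \<le> C * r\<^sup>2 * (\<Sum>x\<in>graph_ball E x\<^sub>0 (2 * r). \<Sum>y\<in>graph_ball E x\<^sub>0 (2 * r).
            \<mu> x y * (f y - f x)\<^sup>2))"

definition condition_P0 :: "('a \<Rightarrow> 'a \<Rightarrow> bool) \<Rightarrow> ('a \<Rightarrow> 'a \<Rightarrow> real) \<Rightarrow> bool" where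
  "condition_P0 E \<mu> \<longleftrightarrow>
    (\<exists>\<alpha>>0. \<forall>x y. E x y \<longrightarrow> \<mu> x y / vertex_weight E \<mu> x \<ge> \<alpha>)"

fun transition ::
    "('a \<Rightarrow> 'a \<Rightarrow> bool) \<Rightarrow> ('a \<Rightarrow> 'a \<Rightarrow> real) \<Rightarrow> nat \<Rightarrow> 'a \<Rightarrow> 'a \<Rightarrow> real" where
  "transition E \<mu> 0 x y = (if x = y then 1 else 0)"
| "transition E \<mu> (Suc n) x y =
    (\<Sum>z | E x z. \<mu> x z / vertex_weight E \<mu> x * transition E \<mu> n z y)"

definition heat_kernel ::
    "('a \<Rightarrow> 'a \<Rightarrow> bool) \<Rightarrow> ('a \<Rightarrow> 'a \<Rightarrow> real) \<Rightarrow> nat \<Rightarrow> 'a \<Rightarrow> 'a \<Rightarrow> real" where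
  "heat_kernel E \<mu> n x y = transition E \<mu> n x y / vertex_weight E \<mu> y"

definition green :: "('a \<Rightarrow> 'a \<Rightarrow> bool) \<Rightarrow> ('a \<Rightarrow> 'a \<Rightarrow> real) \<Rightarrow> 'a \<Rightarrow> 'a \<Rightarrow> ennreal" where
  "green E \<mu> x y = (\<Sum>n. ennreal (heat_kernel E \<mu> n x y))"

text \<open>Intended for \<open>f \<ge> 0\<close> only; \<open>\<infinity> * 0 = 0\<close> holds in \<^typ>\<open>ennreal\<close>.\<close>

definition green_op ::
    "('a \<Rightarrow> 'a \<Rightarrow> bool) \<Rightarrow> ('a \<Rightarrow> 'a \<Rightarrow> real) \<Rightarrow> ('a \<Rightarrow> real) \<Rightarrow> 'a \<Rightarrow> ennreal" where
  "green_op E \<mu> f x =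
    (\<Sum>\<^sub>\<infinity>y. green E \<mu> x y * ennreal (f y) * ennreal (vertex_weight E \<mu> y))"

text \<open>Real powers on \<open>[0, \<infinity>]\<close>, for exponents \<open>a > 0\<close>.\<close>

definition ennpowr :: "ennreal \<Rightarrow> real \<Rightarrow> ennreal" where
  "ennpowr u a = (if u = \<infinity> then \<infinity> else ennreal (enn2real u powr a))"

definition Lq_norm ::
    "('a \<Rightarrow> 'a \<Rightarrow> bool) \<Rightarrow> ('a \<Rightarrow> 'a \<Rightarrow> real) \<Rightarrow> real \<Rightarrow> ('a \<Rightarrow> ennreal) \<Rightarrow> ennreal" where
  "Lq_norm E \<mu> q u =
    ennpowr (\<Sum>\<^sub>\<infinity>x. ennpowr (u x) q * ennreal (vertex_weight E \<mu> x)) (1 / q)"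

definition conj_exponent :: "real \<Rightarrow> real" where
  "conj_exponent p = p / (p - 1)"

lemma conj_exponent:
  assumes "1 < p"
  shows "1 / p + 1 / conj_exponent p = 1"
  using assms by (simp add: conj_exponent_def field_simps)

definition capacity ::
    "('a \<Rightarrow> 'a \<Rightarrow> bool) \<Rightarrow> ('a \<Rightarrow> 'a \<Rightarrow> real) \<Rightarrow> real \<Rightarrow> 'a set \<Rightarrow> ennreal" where
  "capacity E \<mu> p K =
    Sup {ennreal ((\<Sum>x\<in>K. f x * vertex_weight E \<mu> x) powr p) | f :: 'a \<Rightarrow> real.
      (\<forall>x. 0 \<le> f x) \<and> (\<forall>x. x \<notin> K \<longrightarrow> f x = 0)
      \<and> Lq_norm E \<mu> (conj_exponent p) (green_op E \<mu> f) \<le> 1}"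

definition Lp_parabolic :: "('a \<Rightarrow> 'a \<Rightarrow> bool) \<Rightarrow> ('a \<Rightarrow> 'a \<Rightarrow> real) \<Rightarrow> real \<Rightarrow> bool" where
  "Lp_parabolic E \<mu> p \<longleftrightarrow> (\<forall>K. finite K \<longrightarrow> capacity E \<mu> p K = 0)"

context weighted_graph
begin

lemma vertex_weight_pos: "0 < vertex_weight E \<mu> x"
proof -
  obtain y where "y \<noteq> x"
    using infinite_vertices by (metis finite.emptyI finite_insert UNIV_eq_I insertI1)
  with connected[of x y] obtain z where "E x z"
    by (metis converse_rtranclpE)
  then have "{y. E x y} \<noteq> {}" by blast
  then show ?thesis
    unfolding vertex_weight_def
    by (intro sum_pos locally_finite) (auto simp: weight_pos_iff)
qed

lemma relpowp_graph_dist: "(E ^^ graph_dist E x y) x y"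
  unfolding graph_dist_def
  by (rule LeastI_ex) (use connected[of x y] in \<open>simp add: rtranclp_power\<close>)

lemma finite_graph_ball: "finite (graph_ball E x r)"
proof -
  have fin: "finite {y. (E ^^ n) x y}" for n
  proof (induction n)
    case (Suc n)
    have "{y. (E ^^ Suc n) x y} = (\<Union>z\<in>{z. (E ^^ n) x z}. {y. E z y})"
      by auto
    then show ?case using Suc locally_finite by simp
  qed simp
  have "graph_ball E x r \<subseteq> (\<Union>n\<in>{..nat \<lfloor>r\<rfloor>}. {y. (E ^^ n) x y})"
    using relpowp_graph_dist by (fastforce simp: graph_ball_def le_nat_floor)
  then show ?thesis using fin by (auto intro: finite_subset)
qed

end

end

theory Submission
  imports Defs
begin

text \<open>
  Let \<open>u = G f\<close> with \<open>f \<ge> 0\<close> finitely supported, \<open>m = \<Sum> f \<mu>\<close>, and let \<open>A\<close> be the annulus of radii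
  \<open>r\<close> and \<open>6 r\<close>, with \<open>r\<close> so large that \<open>u\<close> is harmonic on \<open>A\<close>. The flux of \<open>u\<close> through a cutoff
  function that drops from 1 to 0 inside \<open>A\<close> is \<open>m\<close>. By Cauchy-Schwarz its square is at most
  \<open>1 / r^2\<close> times the product of \<open>\<Sum> \<bar>\<nabla>u\<bar>^2 u^(\<beta> - 1)\<close> and \<open>\<Sum> u^(1 - \<beta>)\<close>, and Caccioppoli's
  inequality (the equation tested with \<open>u^\<beta> \<phi>^2\<close>) bounds the weighted energy by
  \<open>1 / r^2 \<cdot> \<Sum> u^(1 + \<beta>)\<close>. For \<open>0 < \<beta> < 1\<close> and \<open>1 + \<beta> \<le> q\<close> both power sums are controlled by
  \<open>S = \<Sum> u^q \<mu>\<close> over \<open>A\<close>, which gives \<open>S \<ge> c r^(2 q) V^(1 - q)\<close>. Under the volume hypothesis this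
  is at least \<open>c / (k + 1)\<close> for \<open>r = 7^k\<close>; these annuli are disjoint, so the \<open>q\<close>-norm of \<open>u\<close> is
  infinite unless \<open>m = 0\<close>.
\<close>

section \<open>Inequalities on a single edge\<close>

text \<open>A discrete chain rule: the derivative of the power decreases, so between
  \<open>a\<close> and \<open>b\<close> it is at least its value at \<open>max a b\<close>.\<close>

lemma powr_diff_mult_ge:
  fixes a b \<beta> :: real
  assumes "0 < \<beta>" "\<beta> < 1" "0 \<le> a" "0 \<le> b"
  shows "\<beta> * (a - b)\<^sup>2 * max a b powr (\<beta> - 1) \<le> (a - b) * (a powr \<beta> - b powr \<beta>)"
proof -
  have aux: "\<beta> * (y - x)\<^sup>2 * y powr (\<beta> - 1) \<le> (y - x) * (y powr \<beta> - x powr \<beta>)"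
    if "0 \<le> x" "x < y" for x y :: real
  proof -
    have "\<beta> * (y - x) * y powr (\<beta> - 1) \<le> y powr \<beta> - x powr \<beta>"
    \<comment> \<open>The mean value theorem needs differentiability at the left endpoint, which
      fails at 0; there the claim reduces to \<open>\<beta> \<le> 1\<close>.\<close>
    proof (cases "x = 0")
      case True
      have "y * y powr (\<beta> - 1) = y powr \<beta>"
        using that by (simp add: powr_diff)
      moreover have "\<beta> * y powr \<beta> \<le> 1 * y powr \<beta>"
        using assms by (intro mult_right_mono) auto
      ultimately show ?thesis using True by (simp add: mult.assoc)
    next
      case False
      then have "0 < x" using that by simp
      have "\<exists>z>x. z < y \<and> y powr \<beta> - x powr \<beta> = (y - x) * (\<beta> * z powr (\<beta> - 1))"
        using \<open>0 < x\<close> that by (intro MVT2) (auto intro!: has_real_derivative_powr)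
      then obtain z where z: "x < z" "z < y" "y powr \<beta> - x powr \<beta> = (y - x) * (\<beta> * z powr (\<beta> - 1))"
        by blast
      have "y powr (\<beta> - 1) \<le> z powr (\<beta> - 1)"
        using z \<open>0 < x\<close> assms by (intro powr_mono2') auto
      then have "(y - x) * (\<beta> * y powr (\<beta> - 1)) \<le> (y - x) * (\<beta> * z powr (\<beta> - 1))"
        using that assms by (intro mult_left_mono) auto
      then show ?thesis using z by (simp add: mult_ac)
    qed
    then have "(y - x) * (\<beta> * (y - x) * y powr (\<beta> - 1)) \<le> (y - x) * (y powr \<beta> - x powr \<beta>)"
      using that by (intro mult_left_mono) auto
    then show ?thesis by (simp add: power2_eq_square mult_ac)
  qed
  consider "a = b" | "a < b" | "b < a" by linarith
  then show ?thesis
  proof cases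
    case 2
    then show ?thesis using aux[of a b] assms by (simp add: max_def power2_commute algebra_simps)
  next
    case 3
    then show ?thesis using aux[of b a] assms by (simp add: max_def)
  qed auto
qed

text \<open>\<open>X\<close> and \<open>Y\<close> are cutoff values at the endpoints. By the
  discrete product rule the right-hand difference splits in two: the increment of the power yields
  \<open>\<beta> / 2\<close> times the weighted energy by \<open>powr_diff_mult_ge\<close>, and the
  cross term consumes half of that, up to an error carrying the cutoff gradient.\<close>

lemma caccioppoli_edge:
  fixes a b X Y \<beta> :: real
  assumes "0 < \<beta>" "\<beta> < 1" "0 \<le> a" "0 \<le> b"
  shows "\<beta> / 4 * ((a - b)\<^sup>2 * max a b powr (\<beta> - 1) * (X\<^sup>2 + Y\<^sup>2))
    \<le> (a - b) * (a powr \<beta> * X\<^sup>2 - b powr \<beta> * Y\<^sup>2) + 2 / \<beta> * (max a b powr (1 + \<beta>) * (X - Y)\<^sup>2)"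
proof -
  define M where "M = max a b"
  define T where "T = M powr (\<beta> - 1)"
  have M0: "0 \<le> M" and T0: "0 \<le> T" using assms by (auto simp: M_def T_def)
  have TM: "T * M = M powr \<beta>" and TMM: "T * M\<^sup>2 = M powr (1 + \<beta>)"
    using M0 by (cases "M = 0"; simp add: T_def powr_diff powr_add power2_eq_square)+
  have 1: "\<beta> * (a - b)\<^sup>2 * T * ((X\<^sup>2 + Y\<^sup>2) / 2) \<le> (a - b) * (a powr \<beta> - b powr \<beta>) * ((X\<^sup>2 + Y\<^sup>2) / 2)"
    using powr_diff_mult_ge[OF assms] unfolding T_def M_def by (intro mult_right_mono) auto
  have ab: "(a powr \<beta> + b powr \<beta>) / 2 \<le> T * M"
  proof -
    have "a powr \<beta> \<le> M powr \<beta>" "b powr \<beta> \<le> M powr \<beta>"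
      using assms by (auto intro!: powr_mono2 simp: M_def)
    then show ?thesis using TM by simp
  qed
  have 2: "\<bar>(a - b) * ((a powr \<beta> + b powr \<beta>) / 2) * (X\<^sup>2 - Y\<^sup>2)\<bar> \<le> T * (\<bar>a - b\<bar> * \<bar>X + Y\<bar> * (M * \<bar>X - Y\<bar>))"
  proof -
    have "\<bar>(a - b) * ((a powr \<beta> + b powr \<beta>) / 2) * (X\<^sup>2 - Y\<^sup>2)\<bar>
       = \<bar>a - b\<bar> * ((a powr \<beta> + b powr \<beta>) / 2) * (\<bar>X + Y\<bar> * \<bar>X - Y\<bar>)"
      by (simp add: abs_mult square_diff_square_factored power2_eq_square)
    also have "\<dots> \<le> \<bar>a - b\<bar> * (T * M) * (\<bar>X + Y\<bar> * \<bar>X - Y\<bar>)"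
      by (intro mult_left_mono mult_right_mono ab) auto
    finally show ?thesis by (simp add: mult_ac)
  qed
  \<comment> \<open>The weight \<open>\<beta> / 8\<close> doubles to \<open>\<beta> / 4\<close> once
    \<open>(X + Y)^2\<close> is bounded by \<open>2 * (X^2 + Y^2)\<close>, which leaves half of the
    main term.\<close>
  have amgm: "P * Q \<le> \<beta> / 8 * P\<^sup>2 + 2 / \<beta> * Q\<^sup>2" for P Q :: real
  proof -
    have "0 \<le> (\<beta> * P - 4 * Q)\<^sup>2 / (8 * \<beta>)" using assms by simp
    also have "\<dots> = \<beta> / 8 * P\<^sup>2 + 2 / \<beta> * Q\<^sup>2 - P * Q"
      using assms by (simp add: power2_eq_square field_simps)
    finally show ?thesis by simp
  qed
  have "T * (\<bar>a - b\<bar> * \<bar>X + Y\<bar> * (M * \<bar>X - Y\<bar>))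
      \<le> T * (\<beta> / 8 * (\<bar>a - b\<bar> * \<bar>X + Y\<bar>)\<^sup>2 + 2 / \<beta> * (M * \<bar>X - Y\<bar>)\<^sup>2)"
    by (intro mult_left_mono amgm T0)
  also have "\<dots> = \<beta> / 8 * (a - b)\<^sup>2 * T * (X + Y)\<^sup>2 + 2 / \<beta> * (T * M\<^sup>2 * (X - Y)\<^sup>2)"
    by (simp add: power_mult_distrib algebra_simps)
  also have "\<dots> \<le> \<beta> / 8 * (a - b)\<^sup>2 * T * (2 * (X\<^sup>2 + Y\<^sup>2)) + 2 / \<beta> * (T * M\<^sup>2 * (X - Y)\<^sup>2)"
  proof -
    have "(X + Y)\<^sup>2 \<le> 2 * (X\<^sup>2 + Y\<^sup>2)"
      using zero_le_power2[of "X - Y"] by (simp add: power2_eq_square algebra_simps)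
    then show ?thesis using assms T0 by (intro add_right_mono mult_left_mono) auto
  qed
  finally have 3: "\<bar>(a - b) * ((a powr \<beta> + b powr \<beta>) / 2) * (X\<^sup>2 - Y\<^sup>2)\<bar>
     \<le> \<beta> / 4 * (a - b)\<^sup>2 * T * (X\<^sup>2 + Y\<^sup>2) + 2 / \<beta> * (M powr (1 + \<beta>) * (X - Y)\<^sup>2)"
    using 2 TMM by (simp only: mult.left_commute[of 2])
  have "(a - b) * (a powr \<beta> * X\<^sup>2 - b powr \<beta> * Y\<^sup>2)
    = (a - b) * (a powr \<beta> - b powr \<beta>) * ((X\<^sup>2 + Y\<^sup>2) / 2)
      + (a - b) * ((a powr \<beta> + b powr \<beta>) / 2) * (X\<^sup>2 - Y\<^sup>2)"
    by (simp add: field_simps)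
  then have "\<beta> * (a - b)\<^sup>2 * T * ((X\<^sup>2 + Y\<^sup>2) / 2) - (\<beta> / 4 * (a - b)\<^sup>2 * T * (X\<^sup>2 + Y\<^sup>2))
     \<le> (a - b) * (a powr \<beta> * X\<^sup>2 - b powr \<beta> * Y\<^sup>2) + 2 / \<beta> * (M powr (1 + \<beta>) * (X - Y)\<^sup>2)"
    using 1 3 by linarith
  then show ?thesis by (simp add: M_def[symmetric] T_def[symmetric] mult_ac)
qed

text \<open>Young's inequality with weight \<open>max a b powr (\<beta> - 1)\<close>;
  \<open>t\<close> stays free so that the two sums can be balanced later. \<open>Z\<close> is the
  increment of the flux cutoff, and \<open>X\<close>, \<open>Y\<close> are values of the energy
  cutoff, so \<open>X^2 + Y^2\<close> is at least 1 wherever \<open>Z\<close> matters.\<close>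

lemma flux_edge:
  fixes a b X Y Z t \<beta> :: real
  assumes "0 \<le> a" "0 \<le> b" "0 < t" and "Z \<noteq> 0 \<Longrightarrow> X = 1 \<or> Y = 1"
  shows "(a - b) * Z
    \<le> t / 2 * ((a - b)\<^sup>2 * max a b powr (\<beta> - 1) * (X\<^sup>2 + Y\<^sup>2))
      + 1 / (2 * t) * (max a b powr (1 - \<beta>) * Z\<^sup>2)"
\<comment> \<open>If \<open>max a b = 0\<close> then \<open>a = b = 0\<close> and the left side
  vanishes. The case is separate because \<open>0 powr (\<beta> - 1)\<close> is 0 and cannot serve
  as a divisor.\<close>
proof (cases "Z = 0 \<or> max a b = 0")
  case True
  then show ?thesis
    using assms by (auto simp: max_def split: if_splits)
next
  case False
  define T where "T = max a b powr (\<beta> - 1)"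
  have "0 < max a b" using False assms by auto
  then have T: "0 < T" and Ti: "max a b powr (1 - \<beta>) = 1 / T"
    by (auto simp: T_def powr_minus_divide[symmetric])
  have XY: "1 \<le> X\<^sup>2 + Y\<^sup>2" using False assms(4) by auto
  have "0 \<le> (t * T * (a - b) - Z)\<^sup>2 / (2 * t * T)" using T assms by simp
  also have "\<dots> = t / 2 * ((a - b)\<^sup>2 * T) + 1 / (2 * t) * (1 / T * Z\<^sup>2) - (a - b) * Z"
    using T assms by (simp add: power2_eq_square field_simps)
  finally have "(a - b) * Z \<le> t / 2 * ((a - b)\<^sup>2 * T) + 1 / (2 * t) * (1 / T * Z\<^sup>2)" by simp
  also have "\<dots> \<le> t / 2 * ((a - b)\<^sup>2 * T * (X\<^sup>2 + Y\<^sup>2)) + 1 / (2 * t) * (1 / T * Z\<^sup>2)"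
  proof -
    have "(a - b)\<^sup>2 * T * 1 \<le> (a - b)\<^sup>2 * T * (X\<^sup>2 + Y\<^sup>2)"
      using XY T by (intro mult_left_mono) auto
    then show ?thesis using assms by (intro add_right_mono mult_left_mono) auto
  qed
  finally show ?thesis by (simp add: T_def[symmetric] Ti)
qed

text \<open>After rescaling by \<open>l\<close>, the power with exponent \<open>s\<close> is at most
  1 below the threshold and at most the \<open>q\<close>-th power above it. Summation then bounds
  such power sums by the volume and the \<open>q\<close>-sum.\<close>

lemma powr_le_scaled:
  fixes a b l q s :: real
  assumes "0 \<le> a" "0 \<le> b" "0 < l" "0 < s" "s \<le> q"
  shows "max a b powr s \<le> l powr s * (1 + (a powr q + b powr q) / l powr q)"
proof -
  define M where "M = max a b"
  have M0: "0 \<le> M" using assms by (simp add: M_def)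
  have "(M / l) powr s \<le> 1 + (M / l) powr q"
  proof (cases "M / l \<le> 1")
    case True
    then have "(M / l) powr s \<le> 1" using M0 assms by (intro powr_le1) auto
    then show ?thesis by (smt (verit) powr_ge_zero)
  next
    case False
    then have "(M / l) powr s \<le> (M / l) powr q" using assms by (intro powr_mono) auto
    then show ?thesis by simp
  qed
  then have "l powr s * (M / l) powr s \<le> l powr s * (1 + (M / l) powr q)"
    by (intro mult_left_mono) auto
  then have "M powr s \<le> l powr s * (1 + M powr q / l powr q)"
    using M0 assms by (simp add: powr_divide)
  also have "\<dots> \<le> l powr s * (1 + (a powr q + b powr q) / l powr q)"
    by (intro mult_left_mono add_left_mono divide_right_mono) (auto simp: M_def max_def)
  finally show ?thesis by (simp add: M_def)
qed

section \<open>Radial cutoff profiles\<close>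

text \<open>The argument is distance divided by \<open>r\<close>. This trapezoid is 1 on [3, 4] and
  0 outside [2, 5]. An edge moves the argument by at most 1, so the gradient stays within [1, 6],
  which fixes the annulus.\<close>

definition plateau :: "real \<Rightarrow> real" where
  "plateau t = max 0 (min 1 (min (t - 2) (5 - t)))"

definition ramp :: "real \<Rightarrow> real" where
  "ramp t = max 0 (min 1 (4 - t))"

lemma plateau_lipschitz: "\<bar>s - t\<bar> \<le> e \<Longrightarrow> \<bar>plateau s - plateau t\<bar> \<le> e"
  unfolding plateau_def by linarith

lemma ramp_lipschitz: "\<bar>s - t\<bar> \<le> e \<Longrightarrow> \<bar>ramp s - ramp t\<bar> \<le> e"
  unfolding ramp_def by linarith

lemma plateau_neqD: "plateau s \<noteq> plateau t \<Longrightarrow> \<bar>s - t\<bar> \<le> 1 \<Longrightarrow> 1 \<le> s \<and> s \<le> 6"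
  unfolding plateau_def by (auto simp: max_def min_def split: if_splits)

lemma ramp_neqD: "ramp s \<noteq> ramp t \<Longrightarrow> \<bar>s - t\<bar> \<le> 1 \<Longrightarrow> 1 \<le> s \<and> s \<le> 6"
  unfolding ramp_def by (auto simp: max_def min_def split: if_splits)

text \<open>\<open>ramp\<close> varies only on [3, 4], where \<open>plateau\<close> is 1, and an
  edge of length at most 1 cannot have its endpoints strictly on opposite sides of that
  interval.\<close>

lemma ramp_diff_plateau: "ramp s - ramp t \<noteq> 0 \<Longrightarrow> \<bar>s - t\<bar> \<le> 1 \<Longrightarrow> plateau s = 1 \<or> plateau t = 1"
  unfolding ramp_def plateau_def by (auto simp: max_def min_def split: if_splits)

lemma plateau_nonzeroD: "plateau s \<noteq> 0 \<Longrightarrow> \<bar>s - t\<bar> \<le> 1 \<Longrightarrow> t \<le> 6"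
  unfolding plateau_def by linarith

lemma ramp_nonzeroD: "ramp s \<noteq> 0 \<Longrightarrow> \<bar>s - t\<bar> \<le> 1 \<Longrightarrow> t \<le> 6"
  unfolding ramp_def by linarith

section \<open>Divergence of the annular lower bounds\<close>

lemma filterlim_mult_power_at_top:
  fixes b c :: real
  assumes "0 < c" "1 < b"
  shows "filterlim (\<lambda>k. c * b ^ k) at_top sequentially"
proof (rule filterlim_tendsto_pos_mult_at_top[OF tendsto_const \<open>0 < c\<close>])
  show "filterlim (\<lambda>k. b ^ k) at_top sequentially"
    using assms filterlim_realpow_sequentially_gt1[of b]
    by (intro filterlim_at_infinity_imp_filterlim_at_top) auto
qed

text \<open>The lower bound is a constant times
  \<open>r powr (2 * q) / v (6 * r) powr (q - 1)\<close>. Raising the growth condition to the power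
  \<open>q - 1\<close> makes the exponent of \<open>r\<close> equal to \<open>2 * q\<close> and that
  of the logarithm equal to 1. At \<open>r = 7 ^ k\<close> the logarithm is of order
  \<open>k\<close>, so a harmonic series is a minorant.\<close>

lemma not_summable_volume_growth:
  fixes v :: "real \<Rightarrow> real" and S :: "nat \<Rightarrow> real"
  assumes "1 < p" and q: "q = conj_exponent p" and "0 < c" "0 < C"
    and v: "\<And>r. 1 \<le> r \<Longrightarrow> 0 < v r"
    and growth: "\<forall>\<^sub>F r in at_top. v r \<le> C * r powr (2 * p) * ln r powr (p - 1)"
    and S: "\<forall>\<^sub>F k in sequentially. v (6 * 7 ^ k) * (c * (7 ^ k)\<^sup>2 / v (6 * 7 ^ k)) powr q \<le> S k"
  shows "\<not> summable S"
proof
  assume "summable S"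
  have pq: "p * (q - 1) = q" "(p - 1) * (q - 1) = 1" and "1 < q"
    using \<open>1 < p\<close> by (auto simp: q conj_exponent_def field_simps)
  \<comment> \<open>The factor \<open>6 powr (2 * q)\<close> comes from the outer radius
    \<open>6 * r\<close>, the factor \<open>ln 7\<close> from the logarithm of
    \<open>7 ^ Suc k\<close>.\<close>
  define c' where "c' = c powr q / (C powr (q - 1) * 6 powr (2 * q) * ln 7)"
  have c': "0 < c'" using assms by (simp add: c'_def)
  have "filterlim (\<lambda>k::nat. 6 * 7 ^ k :: real) at_top sequentially"
    by (intro filterlim_mult_power_at_top) auto
  then have "\<forall>\<^sub>F k in sequentially. v (6 * 7 ^ k)
      \<le> C * (6 * 7 ^ k) powr (2 * p) * ln (6 * 7 ^ k) powr (p - 1)"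
    by (rule eventually_compose_filterlim[OF growth])
  with S have "\<forall>\<^sub>F k in sequentially. norm (c' * inverse (real (Suc k))) \<le> S k"
  proof eventually_elim
    case (elim k)
    define r :: real where "r = 7 ^ k"
    define w where "w = v (6 * r)"
    have r: "1 \<le> r" by (simp add: r_def)
    then have w: "0 < w" by (auto simp: w_def intro!: v)
    have ln0: "0 < ln (6 * r)" using r by (intro ln_gt_zero) auto
    \<comment> \<open>Enlarging 6 to 7 gives an exact power of 7, whose index \<open>Suc k\<close>
      is nonzero even for \<open>k = 0\<close>.\<close>
    have "ln (6 * r) \<le> ln (7 * r)" using r by simp
    also have "7 * r = 7 ^ Suc k" by (simp add: r_def)
    also have "ln \<dots> = real (Suc k) * ln 7" by (rule ln_realpow)
    finally have ln7: "ln (6 * r) \<le> real (Suc k) * ln 7" .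
    have "w powr (q - 1) \<le> (C * (6 * r) powr (2 * p) * ln (6 * r) powr (p - 1)) powr (q - 1)"
      using elim(2) w \<open>1 < q\<close> by (intro powr_mono2) (auto simp: w_def r_def)
    also have "\<dots> = C powr (q - 1) * (6 * r) powr (2 * (p * (q - 1))) * ln (6 * r) powr ((p - 1) * (q - 1))"
      using \<open>0 < C\<close> r ln0 by (simp add: powr_mult powr_powr mult.assoc)
    also have "\<dots> = C powr (q - 1) * 6 powr (2 * q) * r powr (2 * q) * ln (6 * r)"
      using r ln0 by (simp add: pq powr_mult)
    also have "\<dots> \<le> C powr (q - 1) * 6 powr (2 * q) * r powr (2 * q) * (real (Suc k) * ln 7)"
      by (intro mult_left_mono ln7) auto
    finally have wq: "w powr (q - 1) \<le> C powr (q - 1) * 6 powr (2 * q) * r powr (2 * q) * (real (Suc k) * ln 7)" .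
    have "c' * inverse (real (Suc k))
        = c powr q * r powr (2 * q) / (C powr (q - 1) * 6 powr (2 * q) * r powr (2 * q) * (real (Suc k) * ln 7))"
      using r by (simp add: c'_def divide_simps)
    also have "\<dots> \<le> c powr q * r powr (2 * q) / w powr (q - 1)"
      using w wq by (intro divide_left_mono mult_pos_pos) (auto intro: less_le_trans)
    also have "\<dots> = w * (c * r\<^sup>2 / w) powr q"
    proof -
      have "r powr (2 * q) = (r\<^sup>2) powr q"
        using r by (simp add: powr_powr[symmetric])
      then show ?thesis
        using w r \<open>0 < c\<close> by (simp add: powr_divide powr_mult powr_diff)
    qed
    also have "\<dots> \<le> S k" using elim(1) by (simp add: w_def r_def)
    finally show ?case using c' by simp
  qed
  then have "summable (\<lambda>k. c' * inverse (real (Suc k)))"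
    using \<open>summable S\<close> by (rule summable_comparison_test_ev)
  then have "summable (\<lambda>k. inverse (real (Suc k)))"
    using c' by (simp add: summable_cmult_iff)
  then show False
    using not_summable_harmonic[where 'a = real] by (simp only: summable_Suc_iff[of "\<lambda>k. inverse (real k)"])
qed

section \<open>Summation by parts and the flux estimate on an annulus\<close>

context weighted_graph
begin

lemma weight_eq_0: "\<not> E x y \<Longrightarrow> \<mu> x y = 0"
  using weight_nonneg[of x y] weight_pos_iff[of x y] by auto

lemma sum_weight_le:
  assumes "finite F"
  shows "(\<Sum>y\<in>F. \<mu> x y) \<le> vertex_weight E \<mu> x"
proof -
  have "(\<Sum>y\<in>F. \<mu> x y) = (\<Sum>y\<in>F \<inter> {y. E x y}. \<mu> x y)"
    using assms by (intro sum.mono_neutral_right) (auto simp: weight_eq_0)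
  also have "\<dots> \<le> vertex_weight E \<mu> x"
    unfolding vertex_weight_def
    by (intro sum_mono2 locally_finite) (auto simp: weight_nonneg)
  finally show ?thesis .
qed

lemma graph_dist_self [simp]: "graph_dist E x x = 0"
  unfolding graph_dist_def by (rule Least_eq_0) simp

lemma graph_dist_adj_le:
  assumes "E x y"
  shows "graph_dist E z y \<le> Suc (graph_dist E z x)"
  using assms relpowp_graph_dist[of z x] unfolding graph_dist_def[of E z y]
  by (intro Least_le) auto

lemma graph_dist_adj:
  assumes "E x y"
  shows "\<bar>real (graph_dist E z x) - real (graph_dist E z y)\<bar> \<le> 1"
  using graph_dist_adj_le[OF assms, of z] graph_dist_adj_le[OF adj_sym[OF assms], of z] by linarith

text \<open>Summation by parts: swapping the variables and symmetry of \<open>\<mu>\<close> make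
  both halves equal, hence the factor 2. \<open>F\<close> contains all neighbours of its vertices
  where \<open>\<eta>\<close> is nonzero, so the inner sums there are full Laplacians.\<close>

lemma green_identity:
  fixes u \<eta> f :: "'a \<Rightarrow> real"
  assumes "finite F"
    and poisson: "\<And>x. u x = f x + (\<Sum>z | E x z. \<mu> x z / vertex_weight E \<mu> x * u z)"
    and supp: "\<And>x y. x \<in> F \<Longrightarrow> \<eta> x \<noteq> 0 \<Longrightarrow> E x y \<Longrightarrow> y \<in> F"
  shows "(\<Sum>x\<in>F. \<Sum>y\<in>F. \<mu> x y * ((u x - u y) * (\<eta> x - \<eta> y)))
    = 2 * (\<Sum>x\<in>F. \<eta> x * f x * vertex_weight E \<mu> x)"
proof -
  have "(\<Sum>x\<in>F. \<Sum>y\<in>F. \<mu> x y * ((u x - u y) * (\<eta> x - \<eta> y)))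
    = (\<Sum>x\<in>F. \<Sum>y\<in>F. \<mu> x y * (u x - u y) * \<eta> x) + (\<Sum>x\<in>F. \<Sum>y\<in>F. \<mu> x y * (u y - u x) * \<eta> y)"
    by (simp add: sum.distrib[symmetric] algebra_simps)
  also have "(\<Sum>x\<in>F. \<Sum>y\<in>F. \<mu> x y * (u y - u x) * \<eta> y) = (\<Sum>x\<in>F. \<Sum>y\<in>F. \<mu> x y * (u x - u y) * \<eta> x)"
    by (subst sum.swap) (simp add: weight_sym)
  also have "(\<Sum>x\<in>F. \<Sum>y\<in>F. \<mu> x y * (u x - u y) * \<eta> x) = (\<Sum>x\<in>F. \<eta> x * f x * vertex_weight E \<mu> x)"
  proof (rule sum.cong[OF refl])
    fix x assume "x \<in> F"
    show "(\<Sum>y\<in>F. \<mu> x y * (u x - u y) * \<eta> x) = \<eta> x * f x * vertex_weight E \<mu> x"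
  proof (cases "\<eta> x = 0")
    case False
    have "(\<Sum>y\<in>F. \<mu> x y * (u x - u y)) = (\<Sum>y | E x y. \<mu> x y * (u x - u y))"
      using False supp[OF \<open>x \<in> F\<close>] assms(1)
      by (intro sum.mono_neutral_right) (auto simp: weight_eq_0)
    also have "\<dots> = vertex_weight E \<mu> x * u x - (\<Sum>y | E x y. \<mu> x y * u y)"
      by (simp add: vertex_weight_def sum_distrib_right right_diff_distrib sum_subtractf)
    also have "(\<Sum>y | E x y. \<mu> x y * u y) = vertex_weight E \<mu> x * (\<Sum>y | E x y. \<mu> x y / vertex_weight E \<mu> x * u y)"
      using vertex_weight_pos[of x] by (simp add: sum_distrib_left)
    also have "vertex_weight E \<mu> x * u x - \<dots> = vertex_weight E \<mu> x * f x"
      by (subst poisson[of x]) (simp add: algebra_simps)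
    finally show ?thesis by (simp add: sum_distrib_right[symmetric])
  qed simp
  qed
  finally show ?thesis by simp
qed


text \<open>Only edges inside \<open>A\<close> contribute, each with a squared gradient of at most
  \<open>1 / r^2\<close>. Of the three copies of \<open>W\<close>, one is the volume and two are the
  \<open>q\<close>-sums attached to the two endpoints.\<close>

lemma sum_cutoff_le:
  fixes u h :: "'a \<Rightarrow> real"
  assumes "finite F" "A \<subseteq> F" and u: "\<And>x. 0 \<le> u x" and "0 < s" "s \<le> q" "0 < l" "0 < r"
    and lip: "\<And>x y. E x y \<Longrightarrow> \<bar>h x - h y\<bar> \<le> 1 / r"
    and supp: "\<And>x y. E x y \<Longrightarrow> h x \<noteq> h y \<Longrightarrow> x \<in> A"
    and W: "(\<Sum>x\<in>A. vertex_weight E \<mu> x) \<le> W"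
    and S: "(\<Sum>x\<in>A. u x powr q * vertex_weight E \<mu> x) \<le> W * l powr q"
  shows "(\<Sum>x\<in>F. \<Sum>y\<in>F. \<mu> x y * (max (u x) (u y) powr s * (h x - h y)\<^sup>2)) \<le> 3 * W * l powr s / r\<^sup>2"
proof -
  have fA: "finite A" using assms(1,2) finite_subset by blast
  define c where "c = l powr s / r\<^sup>2"
  have c0: "0 \<le> c" by (simp add: c_def)
  have mean: "\<mu> x y * (max (u x) (u y) powr s * (h x - h y)\<^sup>2)
      \<le> c * (\<mu> x y + (u x powr q * \<mu> x y + u y powr q * \<mu> y x) / l powr q)" if "E x y" for x y
  proof -
    have "max (u x) (u y) powr s \<le> l powr s * (1 + (u x powr q + u y powr q) / l powr q)"
      using u assms by (intro powr_le_scaled) auto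
    moreover have "(h x - h y)\<^sup>2 \<le> 1 / r\<^sup>2"
      using power_mono[OF lip[OF that], of 2] by (simp add: power_divide)
    ultimately have "max (u x) (u y) powr s * (h x - h y)\<^sup>2
        \<le> l powr s * (1 + (u x powr q + u y powr q) / l powr q) * (1 / r\<^sup>2)"
      by (intro mult_mono) auto
    then have "\<mu> x y * (max (u x) (u y) powr s * (h x - h y)\<^sup>2)
        \<le> \<mu> x y * (l powr s * (1 + (u x powr q + u y powr q) / l powr q) * (1 / r\<^sup>2))"
      by (intro mult_left_mono weight_nonneg)
    also have "\<dots> = c * (\<mu> x y + (u x powr q * \<mu> x y + u y powr q * \<mu> y x) / l powr q)"
      by (simp add: c_def weight_sym[of y x] algebra_simps add_divide_distrib)
    finally show ?thesis .
  qed
  have "(\<Sum>x\<in>F. \<Sum>y\<in>F. \<mu> x y * (max (u x) (u y) powr s * (h x - h y)\<^sup>2))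
     = (\<Sum>x\<in>A. \<Sum>y\<in>A. \<mu> x y * (max (u x) (u y) powr s * (h x - h y)\<^sup>2))"
  proof -
    \<comment> \<open>\<open>supp\<close> speaks of the first endpoint only; the reversed edge gives
      the second.\<close>
    have z: "\<mu> x y * (max (u x) (u y) powr s * (h x - h y)\<^sup>2) = 0" if "x \<notin> A \<or> y \<notin> A" for x y
      using that supp[of x y] supp[of y x] adj_sym[of x y] weight_eq_0[of x y] by (cases "E x y") auto
    have "(\<Sum>x\<in>F. \<Sum>y\<in>F. \<mu> x y * (max (u x) (u y) powr s * (h x - h y)\<^sup>2))
      = (\<Sum>x\<in>A. \<Sum>y\<in>F. \<mu> x y * (max (u x) (u y) powr s * (h x - h y)\<^sup>2))"
      using assms z by (intro sum.mono_neutral_right ballI sum.neutral) auto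
    also have "\<dots> = (\<Sum>x\<in>A. \<Sum>y\<in>A. \<mu> x y * (max (u x) (u y) powr s * (h x - h y)\<^sup>2))"
      using assms z by (intro sum.cong sum.mono_neutral_right ballI) auto
    finally show ?thesis .
  qed
  also have "\<dots> \<le> (\<Sum>x\<in>A. \<Sum>y\<in>A. c * (\<mu> x y + (u x powr q * \<mu> x y + u y powr q * \<mu> y x) / l powr q))"
  proof (intro sum_mono)
    fix x y
    show "\<mu> x y * (max (u x) (u y) powr s * (h x - h y)\<^sup>2)
        \<le> c * (\<mu> x y + (u x powr q * \<mu> x y + u y powr q * \<mu> y x) / l powr q)"
    proof (cases "E x y")
      case False
      then show ?thesis using weight_eq_0[OF False] by (simp add: weight_sym[of y x])
    qed (rule mean)
  qed
  also have "\<dots> = c * ((\<Sum>x\<in>A. \<Sum>y\<in>A. \<mu> x y)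
      + ((\<Sum>x\<in>A. \<Sum>y\<in>A. u x powr q * \<mu> x y) + (\<Sum>x\<in>A. \<Sum>y\<in>A. u y powr q * \<mu> y x)) / l powr q)"
    by (simp add: sum_distrib_left[symmetric] sum.distrib sum_divide_distrib[symmetric])
  also have "(\<Sum>x\<in>A. \<Sum>y\<in>A. u y powr q * \<mu> y x) = (\<Sum>x\<in>A. \<Sum>y\<in>A. u x powr q * \<mu> x y)"
    by (rule sum.swap)
  also have "c * ((\<Sum>x\<in>A. \<Sum>y\<in>A. \<mu> x y)
      + ((\<Sum>x\<in>A. \<Sum>y\<in>A. u x powr q * \<mu> x y) + (\<Sum>x\<in>A. \<Sum>y\<in>A. u x powr q * \<mu> x y)) / l powr q)
     \<le> c * (W + (W * l powr q + W * l powr q) / l powr q)"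
  proof -
    have "(\<Sum>x\<in>A. \<Sum>y\<in>A. \<mu> x y) \<le> (\<Sum>x\<in>A. vertex_weight E \<mu> x)"
      by (intro sum_mono sum_weight_le fA)
    moreover have "(\<Sum>x\<in>A. \<Sum>y\<in>A. u x powr q * \<mu> x y) \<le> (\<Sum>x\<in>A. u x powr q * vertex_weight E \<mu> x)"
      unfolding sum_distrib_left[symmetric]
      by (intro sum_mono mult_left_mono sum_weight_le fA) auto
    ultimately show ?thesis using W S c0
      by (intro mult_left_mono add_mono divide_right_mono) auto
  qed
  also have "\<dots> = 3 * W * l powr s / r\<^sup>2"
    using \<open>0 < l\<close> by (simp add: c_def field_simps)
  finally show ?thesis .
qed

text \<open>
  The parameter \<open>l\<close> stands for an upper bound of the \<open>q\<close>-mean of \<open>u\<close> over the annulus; keeping it free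
  avoids Hoelder's inequality and the degenerate case \<open>u = 0\<close>.
\<close>
lemma poisson_flux_le:
  fixes u f :: "'a \<Rightarrow> real" and z :: 'a
  defines "d \<equiv> \<lambda>x. real (graph_dist E z x)"
  assumes u: "\<And>x. 0 \<le> u x"
    and poisson: "\<And>x. u x = f x + (\<Sum>y | E x y. \<mu> x y / vertex_weight E \<mu> x * u y)"
    and f: "\<And>x. f x \<noteq> 0 \<Longrightarrow> d x \<le> r"
    and \<beta>: "0 < \<beta>" "\<beta> < 1" "1 + \<beta> \<le> q"
    and "1 \<le> r" "0 < l"
    and A: "A = {x. r \<le> d x \<and> d x \<le> 6 * r}"
    and W: "(\<Sum>x\<in>A. vertex_weight E \<mu> x) \<le> W"
    and S: "(\<Sum>x\<in>A. u x powr q * vertex_weight E \<mu> x) \<le> W * l powr q"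
  shows "(\<Sum>x\<in>graph_ball E z r. f x * vertex_weight E \<mu> x) * r\<^sup>2 \<le> 3 * (2 / \<beta>\<^sup>2 + 1 / 4) * W * l"
proof -
  define F where "F = graph_ball E z (6 * r)"
  have F: "F = {x. d x \<le> 6 * r}" by (simp add: F_def graph_ball_def d_def)
  have fin: "finite F" unfolding F_def by (rule finite_graph_ball)
  have AF: "A \<subseteq> F" by (auto simp: A F)
  have adj: "\<bar>d x - d y\<bar> \<le> 1" if "E x y" for x y
    using graph_dist_adj[OF that] by (simp add: d_def)
  have adj': "\<bar>d x / r - d y / r\<bar> \<le> 1 / r" if "E x y" for x y
    using adj[OF that] \<open>1 \<le> r\<close> by (simp add: diff_divide_distrib[symmetric] abs_divide divide_right_mono)
  have r1: "1 / r \<le> 1" using \<open>1 \<le> r\<close> by simp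
  \<comment> \<open>\<open>\<phi>\<close> localizes the energy, the test function being
    \<open>u powr \<beta>\<close> times the square of \<open>\<phi>\<close>; \<open>\<psi>\<close>
    is the test function for the flux.\<close>
  define \<phi> where "\<phi> = (\<lambda>x. plateau (d x / r))"
  define \<psi> where "\<psi> = (\<lambda>x. ramp (d x / r))"
  have adj1: "\<bar>d x / r - d y / r\<bar> \<le> 1" if "E x y" for x y
    using adj'[OF that] r1 by linarith
  have inA: "x \<in> A \<longleftrightarrow> 1 \<le> d x / r \<and> d x / r \<le> 6" for x
    using \<open>1 \<le> r\<close> by (auto simp: A field_simps)
  have inF: "x \<in> F \<longleftrightarrow> d x / r \<le> 6" for x
    using \<open>1 \<le> r\<close> by (auto simp: F field_simps)
  have \<phi>_lip: "\<bar>\<phi> x - \<phi> y\<bar> \<le> 1 / r" if "E x y" for x y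
    unfolding \<phi>_def using that by (intro plateau_lipschitz adj')
  have \<psi>_lip: "\<bar>\<psi> x - \<psi> y\<bar> \<le> 1 / r" if "E x y" for x y
    unfolding \<psi>_def using that by (intro ramp_lipschitz adj')
  have \<phi>_A: "x \<in> A" if "E x y" "\<phi> x \<noteq> \<phi> y" for x y
    unfolding inA using plateau_neqD[OF _ adj1] that by (simp add: \<phi>_def)
  have \<psi>_A: "x \<in> A" if "E x y" "\<psi> x \<noteq> \<psi> y" for x y
    unfolding inA using ramp_neqD[OF _ adj1] that by (simp add: \<psi>_def)
  have \<phi>_1: "\<phi> x = 1 \<or> \<phi> y = 1" if "E x y" "\<psi> x - \<psi> y \<noteq> 0" for x y
    using ramp_diff_plateau[OF _ adj1] that by (simp add: \<phi>_def \<psi>_def)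
  have \<phi>_F: "y \<in> F" if "\<phi> x \<noteq> 0" "E x y" for x y
    unfolding inF using plateau_nonzeroD[OF _ adj1] that by (simp add: \<phi>_def)
  have \<psi>_F: "y \<in> F" if "\<psi> x \<noteq> 0" "E x y" for x y
    unfolding inF using ramp_nonzeroD[OF _ adj1] that by (simp add: \<psi>_def)
  have f': "d x / r \<le> 1" if "f x \<noteq> 0" for x
    using f[OF that] \<open>1 \<le> r\<close> by simp
  define m where "m = (\<Sum>x\<in>graph_ball E z r. f x * vertex_weight E \<mu> x)"
  define D where "D = (\<Sum>x\<in>F. \<Sum>y\<in>F. \<mu> x y *
    ((u x - u y)\<^sup>2 * max (u x) (u y) powr (\<beta> - 1) * ((\<phi> x)\<^sup>2 + (\<phi> y)\<^sup>2)))"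
  define N where "N = (\<lambda>s h. \<Sum>x\<in>F. \<Sum>y\<in>F. \<mu> x y * (max (u x) (u y) powr s * (h x - h y)\<^sup>2))"
  \<comment> \<open>The exponents \<open>1 + \<beta>\<close> and \<open>1 - \<beta>\<close> must lie
    in the range from 0 (excluded) to \<open>q\<close>; this is what the bounds on
    \<open>\<beta>\<close> ensure.\<close>
  have N1: "N (1 + \<beta>) \<phi> \<le> 3 * W * l powr (1 + \<beta>) / r\<^sup>2"
    unfolding N_def using \<beta> \<open>1 \<le> r\<close> \<open>0 < l\<close>
    by (intro sum_cutoff_le[OF fin AF u _ _ _ _ \<phi>_lip \<phi>_A W S]) auto
  have N2: "N (1 - \<beta>) \<psi> \<le> 3 * W * l powr (1 - \<beta>) / r\<^sup>2"
    unfolding N_def using \<beta> \<open>1 \<le> r\<close> \<open>0 < l\<close>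
    by (intro sum_cutoff_le[OF fin AF u _ _ _ _ \<psi>_lip \<psi>_A W S]) auto
  have D: "\<beta> / 4 * D \<le> 2 / \<beta> * N (1 + \<beta>) \<phi>"
  proof -
    have "\<beta> / 4 * D \<le> (\<Sum>x\<in>F. \<Sum>y\<in>F. \<mu> x y * ((u x - u y) * (u x powr \<beta> * (\<phi> x)\<^sup>2 - u y powr \<beta> * (\<phi> y)\<^sup>2)))
        + 2 / \<beta> * N (1 + \<beta>) \<phi>"
      unfolding D_def N_def sum_distrib_left sum.distrib[symmetric]
    proof (intro sum_mono)
      fix x y
      have "\<mu> x y * (\<beta> / 4 * ((u x - u y)\<^sup>2 * max (u x) (u y) powr (\<beta> - 1) * ((\<phi> x)\<^sup>2 + (\<phi> y)\<^sup>2)))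
        \<le> \<mu> x y * ((u x - u y) * (u x powr \<beta> * (\<phi> x)\<^sup>2 - u y powr \<beta> * (\<phi> y)\<^sup>2)
          + 2 / \<beta> * (max (u x) (u y) powr (1 + \<beta>) * (\<phi> x - \<phi> y)\<^sup>2))"
        using u \<beta> by (intro mult_left_mono caccioppoli_edge weight_nonneg) auto
      then show "\<beta> / 4 * (\<mu> x y * ((u x - u y)\<^sup>2 * max (u x) (u y) powr (\<beta> - 1) * ((\<phi> x)\<^sup>2 + (\<phi> y)\<^sup>2)))
        \<le> \<mu> x y * ((u x - u y) * (u x powr \<beta> * (\<phi> x)\<^sup>2 - u y powr \<beta> * (\<phi> y)\<^sup>2))
          + 2 / \<beta> * (\<mu> x y * (max (u x) (u y) powr (1 + \<beta>) * (\<phi> x - \<phi> y)\<^sup>2))"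
        by (simp add: algebra_simps)
    qed
    also have "(\<Sum>x\<in>F. \<Sum>y\<in>F. \<mu> x y * ((u x - u y) * (u x powr \<beta> * (\<phi> x)\<^sup>2 - u y powr \<beta> * (\<phi> y)\<^sup>2)))
        = 2 * (\<Sum>x\<in>F. u x powr \<beta> * (\<phi> x)\<^sup>2 * f x * vertex_weight E \<mu> x)"
      using \<phi>_F by (intro green_identity[OF fin poisson]) auto
    \<comment> \<open>The source sits at rescaled distance at most 1, where \<open>plateau\<close>
      vanishes.\<close>
    also have "(\<Sum>x\<in>F. u x powr \<beta> * (\<phi> x)\<^sup>2 * f x * vertex_weight E \<mu> x) = 0"
    proof (intro sum.neutral ballI)
      fix x
      show "u x powr \<beta> * (\<phi> x)\<^sup>2 * f x * vertex_weight E \<mu> x = 0"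
        using f'[of x] by (cases "f x = 0") (auto simp: \<phi>_def plateau_def)
    qed
    finally show ?thesis by simp
  qed
  \<comment> \<open>This choice balances the two sums: \<open>t * l powr (1 + \<beta>)\<close> and
    \<open>l powr (1 - \<beta>) / t\<close> both equal \<open>l\<close>.\<close>
  define t where "t = l powr (- \<beta>)"
  have t: "0 < t" using \<open>0 < l\<close> by (simp add: t_def)
  \<comment> \<open>\<open>\<psi>\<close> is 1 on the support of \<open>f\<close>, so its flux
    recovers the whole mass.\<close>
  have "2 * m = 2 * (\<Sum>x\<in>F. \<psi> x * f x * vertex_weight E \<mu> x)"
  proof -
    have "m = (\<Sum>x\<in>F. f x * vertex_weight E \<mu> x)"
      unfolding m_def using \<open>1 \<le> r\<close> fin f
      by (intro sum.mono_neutral_left) (auto simp: F graph_ball_def d_def)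
    also have "\<dots> = (\<Sum>x\<in>F. \<psi> x * f x * vertex_weight E \<mu> x)"
    proof (intro sum.cong refl)
      fix x
      show "f x * vertex_weight E \<mu> x = \<psi> x * f x * vertex_weight E \<mu> x"
        using f'[of x] by (cases "f x = 0") (auto simp: \<psi>_def ramp_def)
    qed
    finally show ?thesis by simp
  qed
  also have "\<dots> = (\<Sum>x\<in>F. \<Sum>y\<in>F. \<mu> x y * ((u x - u y) * (\<psi> x - \<psi> y)))"
    using \<psi>_F by (intro green_identity[OF fin poisson, symmetric]) auto
  also have "\<dots> \<le> t / 2 * D + 1 / (2 * t) * N (1 - \<beta>) \<psi>"
    unfolding D_def N_def sum_distrib_left sum.distrib[symmetric]
  proof (intro sum_mono)
    fix x y
    have "\<mu> x y * ((u x - u y) * (\<psi> x - \<psi> y))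
      \<le> \<mu> x y * (t / 2 * ((u x - u y)\<^sup>2 * max (u x) (u y) powr (\<beta> - 1) * ((\<phi> x)\<^sup>2 + (\<phi> y)\<^sup>2))
          + 1 / (2 * t) * (max (u x) (u y) powr (1 - \<beta>) * (\<psi> x - \<psi> y)\<^sup>2))"
    proof (cases "E x y")
      case True
      then show ?thesis
        using u t \<phi>_1[OF True] by (intro mult_left_mono flux_edge weight_nonneg) auto
    qed (simp add: weight_eq_0)
    then show "\<mu> x y * ((u x - u y) * (\<psi> x - \<psi> y))
      \<le> t / 2 * (\<mu> x y * ((u x - u y)\<^sup>2 * max (u x) (u y) powr (\<beta> - 1) * ((\<phi> x)\<^sup>2 + (\<phi> y)\<^sup>2)))
          + 1 / (2 * t) * (\<mu> x y * (max (u x) (u y) powr (1 - \<beta>) * (\<psi> x - \<psi> y)\<^sup>2))"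
      by (simp add: algebra_simps)
  qed
  also have "\<dots> \<le> t / 2 * (8 / \<beta>\<^sup>2 * (3 * W * l powr (1 + \<beta>) / r\<^sup>2))
      + 1 / (2 * t) * (3 * W * l powr (1 - \<beta>) / r\<^sup>2)"
  proof -
    have "D \<le> 8 / \<beta>\<^sup>2 * N (1 + \<beta>) \<phi>"
      using D \<beta> by (simp add: field_simps power2_eq_square)
    also have "\<dots> \<le> 8 / \<beta>\<^sup>2 * (3 * W * l powr (1 + \<beta>) / r\<^sup>2)"
      by (intro mult_left_mono N1) simp
    finally show ?thesis using t by (intro add_mono mult_left_mono N2) auto
  qed
  also have "\<dots> = 2 * (3 * (2 / \<beta>\<^sup>2 + 1 / 4) * W * l / r\<^sup>2)"
  proof -
    have 1: "t * l powr (1 + \<beta>) = l"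
      using \<open>0 < l\<close> by (simp add: t_def powr_add[symmetric])
    have 2: "1 / t * l powr (1 - \<beta>) = l"
      using \<open>0 < l\<close> by (simp add: t_def powr_minus_divide powr_add[symmetric])
    have "t / 2 * (8 / \<beta>\<^sup>2 * (3 * W * l powr (1 + \<beta>) / r\<^sup>2)) + 1 / (2 * t) * (3 * W * l powr (1 - \<beta>) / r\<^sup>2)
      = 12 / \<beta>\<^sup>2 * W / r\<^sup>2 * (t * l powr (1 + \<beta>)) + 3 / 2 * W / r\<^sup>2 * (1 / t * l powr (1 - \<beta>))"
      by (simp add: field_simps)
    then show ?thesis unfolding 1 2 by (simp add: algebra_simps add_divide_distrib)
  qed
  finally have "m \<le> 3 * (2 / \<beta>\<^sup>2 + 1 / 4) * W * l / r\<^sup>2" by simp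
  then show ?thesis using \<open>1 \<le> r\<close> unfolding m_def by (simp add: pos_le_divide_eq)
qed

section \<open>The Green operator and its Poisson equation\<close>

text \<open>The time-zero term is split off and the one-step recursion summed over time. In
  \<open>ennreal\<close> the rearrangement is valid even if \<open>green\<close> is
  infinite.\<close>

lemma green_first_step:
  "green E \<mu> x y = ennreal (heat_kernel E \<mu> 0 x y)
    + (\<Sum>z | E x z. ennreal (\<mu> x z / vertex_weight E \<mu> x) * green E \<mu> z y)"
proof -
  have tr: "0 \<le> transition E \<mu> n a b" for n a b
    by (induction n arbitrary: a)
      (auto intro!: sum_nonneg mult_nonneg_nonneg divide_nonneg_pos weight_nonneg vertex_weight_pos)
  have hk: "0 \<le> heat_kernel E \<mu> n a b" for n a b
    unfolding heat_kernel_def using vertex_weight_pos by (intro divide_nonneg_pos tr)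
  have P: "0 \<le> \<mu> a b / vertex_weight E \<mu> a" for a b
    using weight_nonneg vertex_weight_pos by (intro divide_nonneg_pos)
  have step: "ennreal (heat_kernel E \<mu> (Suc n) x y)
      = (\<Sum>z | E x z. ennreal (\<mu> x z / vertex_weight E \<mu> x) * ennreal (heat_kernel E \<mu> n z y))" for n
  proof -
    have "heat_kernel E \<mu> (Suc n) x y = (\<Sum>z | E x z. \<mu> x z / vertex_weight E \<mu> x * heat_kernel E \<mu> n z y)"
      by (simp add: heat_kernel_def sum_divide_distrib)
    then show ?thesis
      by (simp only: ennreal_mult[OF P hk, symmetric] sum_ennreal[OF mult_nonneg_nonneg[OF P hk]])
  qed
  have "green E \<mu> x y = ennreal (heat_kernel E \<mu> 0 x y) + (\<Sum>n. ennreal (heat_kernel E \<mu> (Suc n) x y))"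
    unfolding green_def using suminf_offset[of "\<lambda>n. ennreal (heat_kernel E \<mu> n x y)" 1]
    by (simp add: summableI)
  also have "(\<Sum>n. ennreal (heat_kernel E \<mu> (Suc n) x y))
      = (\<Sum>z | E x z. ennreal (\<mu> x z / vertex_weight E \<mu> x) * green E \<mu> z y)"
    unfolding step green_def
    by (subst suminf_sum) (auto simp: summableI)
  finally show ?thesis .
qed

lemma green_op_finite:
  assumes "finite K" "\<And>x. x \<notin> K \<Longrightarrow> f x = 0"
  shows "green_op E \<mu> f x = (\<Sum>y\<in>K. green E \<mu> x y * ennreal (f y) * ennreal (vertex_weight E \<mu> y))"
proof -
  have "green_op E \<mu> f x = (\<Sum>\<^sub>\<infinity>y\<in>K. green E \<mu> x y * ennreal (f y) * ennreal (vertex_weight E \<mu> y))"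
    unfolding green_op_def using assms by (intro infsum_cong_neutral) auto
  then show ?thesis using assms by simp
qed

text \<open>The time-zero kernel is the identity divided by the vertex weight, so it contributes
  exactly \<open>f x\<close>; the later times give the averaged Green potential.\<close>

lemma green_op_poisson:
  assumes "finite K" "\<And>x. 0 \<le> f x" "\<And>x. x \<notin> K \<Longrightarrow> f x = 0"
  shows "green_op E \<mu> f x = ennreal (f x)
    + (\<Sum>z | E x z. ennreal (\<mu> x z / vertex_weight E \<mu> x) * green_op E \<mu> f z)"
proof -
  have "(\<Sum>y\<in>K. ennreal (heat_kernel E \<mu> 0 x y) * ennreal (f y) * ennreal (vertex_weight E \<mu> y))
    = (\<Sum>y\<in>K. if y = x then ennreal (f x) else 0)"
  proof (intro sum.cong refl)
    fix y
    show "ennreal (heat_kernel E \<mu> 0 x y) * ennreal (f y) * ennreal (vertex_weight E \<mu> y)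
      = (if y = x then ennreal (f x) else 0)"
      using vertex_weight_pos[of x] assms(2)[of x]
      by (auto simp: heat_kernel_def ennreal_mult''[symmetric] ennreal_mult'[symmetric])
  qed
  also have "\<dots> = ennreal (f x)"
    using assms by (auto simp: sum.delta)
  finally have source: "(\<Sum>y\<in>K. ennreal (heat_kernel E \<mu> 0 x y) * ennreal (f y) * ennreal (vertex_weight E \<mu> y))
    = ennreal (f x)" .
  have G: "green_op E \<mu> f a = (\<Sum>y\<in>K. green E \<mu> a y * ennreal (f y) * ennreal (vertex_weight E \<mu> y))" for a
    using assms by (intro green_op_finite) auto
  have "green_op E \<mu> f x = (\<Sum>y\<in>K. ennreal (heat_kernel E \<mu> 0 x y) * ennreal (f y) * ennreal (vertex_weight E \<mu> y))
    + (\<Sum>y\<in>K. \<Sum>z | E x z. ennreal (\<mu> x z / vertex_weight E \<mu> x) *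
        (green E \<mu> z y * ennreal (f y) * ennreal (vertex_weight E \<mu> y)))"
    unfolding G green_first_step[of x]
    by (simp only: distrib_right sum.distrib sum_distrib_right mult.assoc)
  also have "(\<Sum>y\<in>K. \<Sum>z | E x z. ennreal (\<mu> x z / vertex_weight E \<mu> x) *
        (green E \<mu> z y * ennreal (f y) * ennreal (vertex_weight E \<mu> y)))
    = (\<Sum>z | E x z. ennreal (\<mu> x z / vertex_weight E \<mu> x) * green_op E \<mu> f z)"
    unfolding G sum_distrib_left by (rule sum.swap)
  finally show ?thesis unfolding source .
qed

text \<open>Passes from extended-valued infinite sums to real finite ones. Vertex weights are
  positive, so one infinite value would already make the norm infinite.\<close>

lemma Lq_norm_le_one:
  assumes "0 < q" "Lq_norm E \<mu> q u \<le> 1"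
  shows "u x < \<infinity>" and "finite F \<Longrightarrow> (\<Sum>x\<in>F. enn2real (u x) powr q * vertex_weight E \<mu> x) \<le> 1"
proof -
  define g where "g = (\<lambda>x. ennpowr (u x) q * ennreal (vertex_weight E \<mu> x))"
  have I: "infsum g UNIV \<le> 1"
  proof -
    have le: "ennpowr (infsum g UNIV) (1 / q) \<le> 1"
      using assms by (simp add: Lq_norm_def g_def)
    then have fin: "infsum g UNIV \<noteq> \<infinity>"
      by (auto simp: ennpowr_def top_unique)
    then have "enn2real (infsum g UNIV) powr (1 / q) \<le> 1"
      using le by (simp add: ennpowr_def)
    then have "(enn2real (infsum g UNIV) powr (1 / q)) powr q \<le> 1"
      using assms by (intro powr_le1) auto
    then have "enn2real (infsum g UNIV) \<le> 1"
      using assms by (simp add: powr_powr)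
    then show ?thesis
      using fin by (metis ennreal_enn2real ennreal_le_1 infinity_ennreal_def less_top)
  qed
  have sum_le: "sum g F \<le> 1" if "finite F" for F
  proof -
    have "sum g F \<le> (SUP F\<in>{F. finite F \<and> F \<subseteq> UNIV}. sum g F)"
      using that by (intro SUP_upper) auto
    also have "\<dots> = infsum g UNIV"
      by (rule nonneg_infsum_complete[symmetric]) simp
    finally show ?thesis using I by (rule order_trans)
  qed
  show fin: "u x < \<infinity>" for x
  proof (rule ccontr)
    assume "\<not> u x < \<infinity>"
    then have "g x = \<infinity>"
      using vertex_weight_pos[of x] by (simp add: g_def ennpowr_def top.not_eq_extremum ennreal_top_mult)
    then show False using sum_le[of "{x}"] by (simp add: top_unique)
  qed
  show "(\<Sum>x\<in>F. enn2real (u x) powr q * vertex_weight E \<mu> x) \<le> 1" if "finite F"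
  proof -
    have "g x = ennreal (enn2real (u x) powr q * vertex_weight E \<mu> x)" for x
      using fin[of x] vertex_weight_pos[of x] by (simp add: g_def ennpowr_def ennreal_mult')
    then show ?thesis
      using sum_le[OF that] less_imp_le[OF vertex_weight_pos]
      by (simp add: sum_ennreal)
  qed
qed

section \<open>Contradiction over disjoint annuli\<close>

lemma Lq_green_op_imp_zero:
  fixes f :: "'a \<Rightarrow> real"
  assumes "1 < p" and "0 < C"
    and growth: "\<forall>\<^sub>F r in at_top. graph_volume E \<mu> z r \<le> C * r powr (2 * p) * ln r powr (p - 1)"
    and K: "finite K" and f0: "\<And>x. 0 \<le> f x" and fK: "\<And>x. x \<notin> K \<Longrightarrow> f x = 0"
    and norm: "Lq_norm E \<mu> (conj_exponent p) (green_op E \<mu> f) \<le> 1"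
  shows "(\<Sum>x\<in>K. f x * vertex_weight E \<mu> x) = 0"
proof (rule ccontr)
  define m where "m = (\<Sum>x\<in>K. f x * vertex_weight E \<mu> x)"
  assume "(\<Sum>x\<in>K. f x * vertex_weight E \<mu> x) \<noteq> 0"
  moreover have "0 \<le> m"
    unfolding m_def by (intro sum_nonneg mult_nonneg_nonneg f0 less_imp_le[OF vertex_weight_pos])
  ultimately have m: "0 < m" by (simp add: m_def)
  define q where "q = conj_exponent p"
  have q: "1 < q" using \<open>1 < p\<close> by (simp add: q_def conj_exponent_def)
  define u where "u = (\<lambda>x. enn2real (green_op E \<mu> f x))"
  note Lq = Lq_norm_le_one[OF _ norm[folded q_def]]
  have Gu: "green_op E \<mu> f x = ennreal (u x)" for x
    using Lq(1)[of x] q by (simp add: u_def)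
  have u0: "0 \<le> u x" for x by (simp add: u_def)
  have P: "0 \<le> \<mu> a b / vertex_weight E \<mu> a" for a b
    using weight_nonneg vertex_weight_pos by (intro divide_nonneg_pos)
  \<comment> \<open>Since the potential is finite everywhere, its equation in \<open>ennreal\<close>
    descends to the reals.\<close>
  have poisson: "u x = f x + (\<Sum>y | E x y. \<mu> x y / vertex_weight E \<mu> x * u y)" for x
  proof -
    have "green_op E \<mu> f x = ennreal (f x)
        + (\<Sum>y | E x y. ennreal (\<mu> x y / vertex_weight E \<mu> x) * green_op E \<mu> f y)"
      by (rule green_op_poisson[OF K f0 fK])
    also have "\<dots> = ennreal (f x + (\<Sum>y | E x y. \<mu> x y / vertex_weight E \<mu> x * u y))"
      by (simp only: Gu ennreal_mult[OF P u0, symmetric] sum_ennreal[OF mult_nonneg_nonneg[OF P u0]]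
        ennreal_plus[OF f0 sum_nonneg[OF mult_nonneg_nonneg[OF P u0]]])
    finally have "ennreal (u x) = ennreal (f x + (\<Sum>y | E x y. \<mu> x y / vertex_weight E \<mu> x * u y))"
      by (simp only: Gu)
    then show ?thesis
      by (simp only: ennreal_inj[OF u0 add_nonneg_nonneg[OF f0 sum_nonneg[OF mult_nonneg_nonneg[OF P u0]]]])
  qed
  \<comment> \<open>The minimum meets both \<open>\<beta> < 1\<close> and
    \<open>1 + \<beta> \<le> q\<close>, however close \<open>q\<close> is to 1.\<close>
  define \<beta> where "\<beta> = min (1 / 2) (q - 1)"
  have \<beta>: "0 < \<beta>" "\<beta> < 1" "1 + \<beta> \<le> q" using q by (auto simp: \<beta>_def)
  define B where "B = 3 * (2 / \<beta>\<^sup>2 + 1 / 4)"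
  have B: "0 < B" by (simp add: B_def add_nonneg_pos)
  define A where "A = (\<lambda>k::nat. {x. 7 ^ k \<le> real (graph_dist E z x) \<and> real (graph_dist E z x) \<le> 6 * 7 ^ k})"
  define S where "S = (\<lambda>k. \<Sum>x\<in>A k. u x powr q * vertex_weight E \<mu> x)"
  define v where "v = graph_volume E \<mu> z"
  have A_ball: "A k \<subseteq> graph_ball E z (6 * 7 ^ k)" for k
    by (auto simp: A_def graph_ball_def)
  then have fin: "finite (A k)" for k
    using finite_graph_ball finite_subset by blast
  have term0: "0 \<le> u x powr q * vertex_weight E \<mu> x" for x
    using vertex_weight_pos[of x] by simp
  \<comment> \<open>The outer radius \<open>6 * 7 ^ i\<close> is smaller than the next inner radius
    \<open>7 * 7 ^ i\<close>.\<close>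
  have disj: "A i \<inter> A j = {}" if "i < j" for i j
  proof -
    have "7 ^ Suc i \<le> (7::real) ^ j" using that by (intro power_increasing) auto
    moreover have "(0::real) < 7 ^ i" by simp
    ultimately have "\<not> (x \<in> A i \<and> x \<in> A j)" for x
      unfolding A_def mem_Collect_eq power_Suc by linarith
    then show ?thesis by blast
  qed
  have "summable S"
  proof (rule summableI_nonneg_bounded)
    show "0 \<le> S n" for n
      unfolding S_def by (intro sum_nonneg term0)
    show "sum S {..<n} \<le> 1" for n
    proof -
      have "sum S {..<n} = (\<Sum>x\<in>(\<Union>k<n. A k). u x powr q * vertex_weight E \<mu> x)"
        unfolding S_def using fin disj
        by (intro sum.UNION_disjoint[symmetric]) (auto, metis disjoint_iff linorder_neqE_nat)
      also have "\<dots> \<le> 1" unfolding u_def using fin q by (intro Lq(2)) auto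
      finally show ?thesis .
    qed
  qed
  moreover have "\<not> summable S"
  proof (rule not_summable_volume_growth[OF \<open>1 < p\<close> q_def])
    show "0 < m / (2 * B)" using m B by simp
    show "0 < C" by fact
    show v0: "0 < v r" if "1 \<le> r" for r
      unfolding v_def graph_volume_def using that
      by (intro sum_pos finite_graph_ball vertex_weight_pos) (auto simp: graph_ball_def intro!: exI[of _ z])
    show "\<forall>\<^sub>F r in at_top. v r \<le> C * r powr (2 * p) * ln r powr (p - 1)"
      using growth by (simp add: v_def)
    obtain R where R: "\<And>x. x \<in> K \<Longrightarrow> real (graph_dist E z x) \<le> R"
      using finite_imageI[OF K, of "\<lambda>x. real (graph_dist E z x)"]
      by (meson Max_ge imageI)
    have "\<forall>\<^sub>F k in sequentially. R \<le> 7 ^ k"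
      using filterlim_mult_power_at_top[of 1 7] by (simp add: filterlim_at_top)
    then show "\<forall>\<^sub>F k in sequentially.
        v (6 * 7 ^ k) * (m / (2 * B) * (7 ^ k)\<^sup>2 / v (6 * 7 ^ k)) powr q \<le> S k"
    proof eventually_elim
      case (elim k)
      define r :: real where "r = 7 ^ k"
      define w where "w = v (6 * r)"
      have r: "1 \<le> r" by (simp add: r_def)
      then have w: "0 < w" by (auto simp: w_def intro!: v0)
      \<comment> \<open>\<open>l\<close> is half the value at which the flux estimate would be an
        equality, so a smaller \<open>S k\<close> would force
        \<open>m * r^2 \<le> m * r^2 / 2\<close>.\<close>
      define l where "l = m / (2 * B) * r\<^sup>2 / w"
      have l: "0 < l" using m B w r by (simp add: l_def)
      show ?case
      proof (rule ccontr)
        assume "\<not> ?thesis"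
        then have S: "S k \<le> w * l powr q" by (simp add: l_def w_def r_def)
        have fr: "f x \<noteq> 0 \<Longrightarrow> real (graph_dist E z x) \<le> r" for x
          using R[of x] fK[of x] elim unfolding r_def by (meson order_trans)
        have W: "(\<Sum>x\<in>A k. vertex_weight E \<mu> x) \<le> w"
          unfolding w_def v_def graph_volume_def r_def
          by (intro sum_mono2 finite_graph_ball A_ball less_imp_le[OF vertex_weight_pos])
        have "(\<Sum>x\<in>graph_ball E z r. f x * vertex_weight E \<mu> x) * r\<^sup>2 \<le> B * w * l"
          unfolding B_def using S
          by (intro poisson_flux_le[OF u0 poisson fr \<beta> r l _ W]) (auto simp: A_def r_def S_def)
        also have "(\<Sum>x\<in>graph_ball E z r. f x * vertex_weight E \<mu> x) = m"
          unfolding m_def using K fK fr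
          by (intro sum.mono_neutral_cong finite_graph_ball) (auto simp: graph_ball_def)
        also have "B * w * l = m * r\<^sup>2 / 2" using B w by (simp add: l_def)
        finally show False using m r by simp
      qed
    qed
  qed
  ultimately show False by contradiction
qed

end

theorem theorem1p11:
  fixes E :: "'a \<Rightarrow> 'a \<Rightarrow> bool" and \<mu> :: "'a \<Rightarrow> 'a \<Rightarrow> real" and p :: real
  assumes "1 < p"
    and "weighted_graph E \<mu>"
    and "volume_doubling E \<mu>"
    and "poincare_inequality E \<mu>"
    and "condition_P0 E \<mu>"
    and "\<exists>x\<^sub>0. \<exists>C>0. \<forall>\<^sub>F r in at_top.
           graph_volume E \<mu> x\<^sub>0 r \<le> C * r powr (2 * p) * ln r powr (p - 1)"
  shows "Lp_parabolic E \<mu> p"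
proof -
  interpret weighted_graph E \<mu> by fact
  obtain z C where "0 < C"
    "\<forall>\<^sub>F r in at_top. graph_volume E \<mu> z r \<le> C * r powr (2 * p) * ln r powr (p - 1)"
    using assms(6) by blast
  note zero = Lq_green_op_imp_zero[OF \<open>1 < p\<close> this]
  show ?thesis
    unfolding Lp_parabolic_def capacity_def
  proof (intro allI impI)
    fix K :: "'a set" assume "finite K"
    show "Sup {ennreal ((\<Sum>x\<in>K. f x * vertex_weight E \<mu> x) powr p) | f :: 'a \<Rightarrow> real.
      (\<forall>x. 0 \<le> f x) \<and> (\<forall>x. x \<notin> K \<longrightarrow> f x = 0)
      \<and> Lq_norm E \<mu> (conj_exponent p) (green_op E \<mu> f) \<le> 1} = 0"
      \<comment> \<open>Every admissible \<open>f\<close> has mass 0 and \<open>0 powr p\<close> is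
        0, so no member of the set exceeds the bottom element.\<close>
      unfolding bot_ennreal[symmetric] Sup_bot_conv
      using zero[OF \<open>finite K\<close>] by (auto simp: bot_ennreal)
  qed
qed

end
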